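(* Let $G$ be a locally precompact topological group. The following conditions are equivalent: (i) $G$ is metrizable; (ii) $G$ is a $\mathfrak{P}$-space; (iii) $G$ has the strong Pytkeev property.
   Context: All topological spaces (in particular topological groups) are Hausdorff. A subset $E$ of a topological group $G$ is precompact if for every open neighborhood $U$ of the unit there is a finite set $F\subset G$ with $E\subseteq F\cdot U$ and $E\subseteq U\cdot F$. $G$ is locally precompact if it has a base at the unit consisting of symmetric precompact sets (equivalently, $G$ embeds as a topological subgroup into a locally compact group). A family $\mathcal N$ of subsets of a topological space $X$ is a $cp$-network at a point $x\in X$ if either $x$ is an isolated point of $X$ and $\{x\}\in\mathcal N$, or for each subset $A\subset X$ with $x\in\overline A\setminus A$ and each neighborhood $O_x$ of $x$ there is $N\in\mathcal N$ such that $x\in N\subset O_x$ and $N\cap A$ is infinite. $\mathcal N$ is a $cp$-network in $X$ if it is a $cp$-network at each point of $X$. A family of sets is $\sigma$-locally finite if it is a countable union of locally finite families. A $\mathfrak{P}$-space is a regular space having a $\sigma$-locally finite $cp$-network. A topological space $X$ has the strong Pytkeev property if for each $x\in X$ there is a countable family $\mathcal D$ of subsets of $X$ such that for each neighborhood $U$ of $x$ and each $A\subseteq X$ with $x\in\overline A\setminus A$ there is $D\in\mathcal D$ such that $D\subseteq U$ and $D\cap A$ is infinite. *)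

theory Defs
  imports "HOL-Analysis.Analysis" "HOL-Library.Set_Algebras"
begin

text \<open>
  Topological groups are types of class \<open>topological_group_add\<close>. This class is based on
  \<open>group_add\<close>, which is additive in notation only: commutativity is not assumed. So \<open>F + U\<close>,
  the elementwise sum of sets, stands for the product \<open>F \<cdot> U\<close>, and the unit is \<open>0\<close>.
\<close>

definition precompact :: "'a::topological_group_add set \<Rightarrow> bool" where
  "precompact E \<longleftrightarrow>
     (\<forall>U. open U \<and> 0 \<in> U \<longrightarrow> (\<exists>F. finite F \<and> E \<subseteq> F + U \<and> E \<subseteq> U + F))"

definition locally_precompact :: "'a::topological_group_add itself \<Rightarrow> bool" where
  "locally_precompact (_ :: 'a itself) \<longleftrightarrow>
     neighbourhood_base_at (0::'a) (\<lambda>V. uminus ` V = V \<and> precompact V) euclidean"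

text \<open>
  The second alternative below is vacuously true at an isolated point \<open>x\<close>, as no \<open>A\<close> then
  satisfies \<open>x \<in> closure A - A\<close>; we keep the customary disjunctive wording. For topological
  groups, the resulting class of \<open>P\<close>-spaces is the same if \<open>{x} \<in> \<N>\<close> is required at every
  isolated point: such a group either has no isolated points or is discrete, and then the
  family of all singletons is locally finite.
\<close>

definition cp_network_at :: "'a topology \<Rightarrow> 'a \<Rightarrow> 'a set set \<Rightarrow> bool" where
  "cp_network_at X x \<N> \<longleftrightarrow>
     (openin X {x} \<and> {x} \<in> \<N>) \<or>
     (\<forall>A U. A \<subseteq> topspace X \<and> x \<in> X closure_of A - A \<and> openin X U \<and> x \<in> U \<longrightarrow>
        (\<exists>N\<in>\<N>. x \<in> N \<and> N \<subseteq> U \<and> infinite (N \<inter> A)))"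

definition cp_network :: "'a topology \<Rightarrow> 'a set set \<Rightarrow> bool" where
  "cp_network X \<N> \<longleftrightarrow> \<N> \<subseteq> Pow (topspace X) \<and> (\<forall>x\<in>topspace X. cp_network_at X x \<N>)"

definition sigma_locally_finite_in :: "'a topology \<Rightarrow> 'a set set \<Rightarrow> bool" where
  "sigma_locally_finite_in X \<N> \<longleftrightarrow>
     (\<exists>\<A> :: nat \<Rightarrow> 'a set set. (\<forall>n. locally_finite_in X (\<A> n)) \<and> \<N> = (\<Union>n. \<A> n))"

text \<open>
  The library's \<open>regular_space\<close> includes no separation of points, hence the explicit
  Hausdorff condition.
\<close>

definition P_space :: "'a topology \<Rightarrow> bool" where
  "P_space X \<longleftrightarrow>
     Hausdorff_space X \<and> regular_space X \<and>
     (\<exists>\<N>. cp_network X \<N> \<and> sigma_locally_finite_in X \<N>)"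

definition strong_Pytkeev :: "'a topology \<Rightarrow> bool" where
  "strong_Pytkeev X \<longleftrightarrow>
     (\<forall>x\<in>topspace X. \<exists>\<D>. countable \<D> \<and> \<D> \<subseteq> Pow (topspace X) \<and>
        (\<forall>U A. openin X U \<and> x \<in> U \<and> A \<subseteq> topspace X \<and> x \<in> X closure_of A - A \<longrightarrow>
           (\<exists>D\<in>\<D>. D \<subseteq> U \<and> infinite (D \<inter> A))))"

end

theory Submission
  imports Defs
begin

text \<open>
  Suppose \<open>G\<close> has the strong Pytkeev property, with countable family \<open>\<D>\<close> at the unit, and let \<open>V\<close> be
  a precompact neighbourhood of the unit. For every neighbourhood \<open>U\<close> of the unit some finite union
  \<open>E \<subseteq> U\<close> of members of \<open>\<D>\<close> has finitely many translates covering \<open>V\<close>. One of the translates is then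
  somewhere dense, so the closure of \<open>- E + E\<close> is a neighbourhood of the unit. These closures form a
  countable base at the unit, and Birkhoff--Kakutani gives a metric; no completion of \<open>G\<close> is used.

  Conversely, a metrizable locally precompact group has an open subgroup that is covered by countably
  many translates of each neighbourhood of the unit, hence is second countable. Copying a countable
  base of it to all cosets gives a \<open>\<sigma>\<close>-locally finite base, which is a cp-network. The remaining
  implication holds in every space, as only countably many members of the network contain a given
  point.
\<close>

section \<open>Small neighbourhoods in a topological group\<close>

lemmas add_assoc_minus_add = add.assoc minus_add

lemma add_nhds:
  fixes a b :: "'a::topological_monoid_add"
  assumes "open U" "a + b \<in> U"
  obtains A B where "open A" "open B" "a \<in> A" "b \<in> B" "\<And>x y. x \<in> A \<Longrightarrow> y \<in> B \<Longrightarrow> x + y \<in> U"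
proof -
  have "eventually (\<lambda>z. fst z + snd z \<in> U) (nhds a \<times>\<^sub>F nhds b)"
    using tendsto_add_Pair assms by (rule topological_tendstoD)
  then obtain P Q where "eventually P (nhds a)" "eventually Q (nhds b)"
    and PQ: "\<And>x y. P x \<Longrightarrow> Q y \<Longrightarrow> x + y \<in> U"
    unfolding eventually_prod_filter by auto
  moreover from this obtain A B where "open A" "a \<in> A" "\<forall>x\<in>A. P x" "open B" "b \<in> B" "\<forall>y\<in>B. Q y"
    unfolding eventually_nhds by blast
  ultimately show thesis
    using that[of A B] PQ by blast
qed

lemma open_uminus_vimage:
  fixes U :: "'a::topological_group_add set"
  shows "open U \<Longrightarrow> open {x. - x \<in> U}"
  using open_vimage[of U uminus] by (simp add: vimage_def continuous_intros)

lemma open_translate_vimage: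
  fixes U :: "'a::topological_group_add set"
  assumes "open U"
  shows "open {x. a + x \<in> U}" "open {x. x + a \<in> U}"
  using open_vimage[OF assms, of "\<lambda>x. a + x"] open_vimage[OF assms, of "\<lambda>x. x + a"]
  by (simp_all add: vimage_def continuous_intros)

lemma symmetric_nhd:
  fixes U :: "'a::topological_group_add set"
  assumes "open U" "0 \<in> U"
  obtains W where "open W" "0 \<in> W" "W \<subseteq> U" "\<And>x. x \<in> W \<Longrightarrow> - x \<in> W"
    "\<And>x y. x \<in> W \<Longrightarrow> y \<in> W \<Longrightarrow> x + y \<in> U"
    "\<And>x y z. x \<in> W \<Longrightarrow> y \<in> W \<Longrightarrow> z \<in> W \<Longrightarrow> x + y + z \<in> U"
proof -
  obtain A B where AB: "open A" "open B" "0 \<in> A" "0 \<in> B" "\<And>x y. x \<in> A \<Longrightarrow> y \<in> B \<Longrightarrow> x + y \<in> U"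
    using add_nhds[of U 0 0] assms by auto
  \<comment> \<open>A second halving handles triple sums: the first two summands add up to an
    element of \<open>A\<close>, and the third lies in \<open>B\<close>.\<close>
  obtain A' B' where AB': "open A'" "open B'" "0 \<in> A'" "0 \<in> B'"
    "\<And>x y. x \<in> A' \<Longrightarrow> y \<in> B' \<Longrightarrow> x + y \<in> A"
    using add_nhds[of A 0 0] AB by auto
  define S where "S = A \<inter> B \<inter> A' \<inter> B' \<inter> U"
  have S: "open S" "0 \<in> S"
    using AB AB' assms by (auto simp: S_def)
  define W where "W = S \<inter> {x. - x \<in> S}"
  show thesis
  proof (rule that)
    show "open W"
      unfolding W_def using S open_uminus_vimage by blast
  qed (use S AB AB' in \<open>auto simp: W_def S_def\<close>)
qed

section \<open>The Birkhoff--Kakutani theorem\<close>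

text \<open>Cut at the first entry \<open>y\<close> after which the remaining weight is at most
  \<open>a\<close>. Unless \<open>ys\<close> is empty, the part from \<open>y\<close> on still
  weighs more than \<open>a\<close>, which bounds the prefix.\<close>

lemma weighted_list_split:
  fixes w :: "'b \<Rightarrow> real"
  assumes "\<And>x. w x \<ge> 0" "xs \<noteq> []" "sum_list (map w xs) \<le> 2 * a"
  obtains ys y zs where "xs = ys @ y # zs" "sum_list (map w ys) \<le> a" "sum_list (map w zs) \<le> a"
proof -
  have "0 \<le> sum_list (map w xs)"
    using assms(1) by (intro sum_list_nonneg) auto
  then have "0 \<le> a"
    using assms(3) by simp
  \<comment> \<open>Only the bound on the prefix varies in the induction: every head that is passed
    over is charged to the prefix.\<close>
  have "\<exists>ys y zs. xs = ys @ y # zs \<and> sum_list (map w ys) \<le> b \<and> sum_list (map w zs) \<le> a"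
    if "xs \<noteq> []" "sum_list (map w xs) \<le> b + a" "b \<ge> 0" for b
    using that
  proof (induction xs arbitrary: b)
    case (Cons x xs)
    show ?case
    proof (cases "sum_list (map w xs) \<le> a")
      case True
      then show ?thesis
        using Cons.prems by (intro exI[of _ "[]"]) auto
    next
      case False
      then have "xs \<noteq> []"
        using \<open>0 \<le> a\<close> by auto
      then obtain ys y zs where
        "xs = ys @ y # zs" "sum_list (map w ys) \<le> b - w x" "sum_list (map w zs) \<le> a"
        using Cons.IH[of "b - w x"] Cons.prems False by auto
      then show ?thesis
        by (intro exI[of _ "x # ys"] exI[of _ y] exI[of _ zs]) auto
    qed
  qed simp
  then show thesis
    using that assms \<open>0 \<le> a\<close> by (metis mult_2)
qed

text \<open>Triple sums are used because a factorization is later split into a prefix, one entry and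
  a suffix. \<open>U_0\<close> lets every element be factored, so that the infimum defining its
  length ranges over a nonempty set.\<close>

locale halving_nhds =
  fixes U :: "nat \<Rightarrow> 'a::{topological_group_add, t2_space} set"
  assumes U_0: "U 0 = UNIV"
    and open_U: "open (U n)"
    and zero_U: "0 \<in> U n"
    and uminus_U: "x \<in> U n \<Longrightarrow> - x \<in> U n"
    and add_U: "x \<in> U (Suc n) \<Longrightarrow> y \<in> U (Suc n) \<Longrightarrow> z \<in> U (Suc n) \<Longrightarrow> x + y + z \<in> U n"
    and U_base: "open S \<Longrightarrow> 0 \<in> S \<Longrightarrow> \<exists>n. U n \<subseteq> S"
begin

lemma antimono_U: "m \<le> n \<Longrightarrow> U n \<subseteq> U m"
proof (induction rule: dec_induct)
  case (step n)
  have "U (Suc n) \<subseteq> U n"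
    using add_U[of _ n 0 0] zero_U by auto
  with step show ?case by blast
qed simp

text \<open>
  A chain factors its total into elements of the sets \<open>U n\<close>, each at cost \<open>(1/2) ^ n\<close>; the length of
  an element is the infimal cost of factoring it.
\<close>

definition chain :: "(nat \<times> 'a) list \<Rightarrow> bool" where
  "chain xs \<longleftrightarrow> (\<forall>(n, g) \<in> set xs. g \<in> U n)"

abbreviation weight :: "(nat \<times> 'a) list \<Rightarrow> real" where
  "weight xs \<equiv> sum_list (map (\<lambda>x. (1/2) ^ fst x) xs)"

abbreviation total :: "(nat \<times> 'a) list \<Rightarrow> 'a" where
  "total xs \<equiv> sum_list (map snd xs)"

lemma weight_nonneg: "0 \<le> weight xs"
  by (rule sum_list_nonneg) auto

text \<open>This keeps the infimal cost from collapsing to zero. After a split at half the weight,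
  prefix and suffix have totals in \<open>U (Suc n)\<close> by induction, while the middle entry
  costs less than \<open>(1/2) ^ n\<close> and so has index at least \<open>Suc n\<close>.\<close>

lemma total_chain_in_U: "chain xs \<Longrightarrow> weight xs < (1/2) ^ n \<Longrightarrow> total xs \<in> U n"
proof (induction xs arbitrary: n rule: length_induct)
  case (1 xs)
  show ?case
  proof (cases "xs = []")
    case True
    then show ?thesis by (simp add: zero_U)
  next
    case False
    then obtain ys y zs where xs: "xs = ys @ y # zs"
      and *: "weight ys \<le> weight xs / 2" "weight zs \<le> weight xs / 2"
      by (elim weighted_list_split[of "\<lambda>x. (1/2) ^ fst x" xs "weight xs / 2", rotated]) simp_all
    have "weight ys < (1/2) ^ Suc n" "weight zs < (1/2) ^ Suc n"
      using * "1.prems"(2) by simp_all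
    moreover have "chain ys" "chain zs" "snd y \<in> U (fst y)"
      using "1.prems"(1) by (auto simp: chain_def xs)
    ultimately have "total ys \<in> U (Suc n)" "total zs \<in> U (Suc n)"
      using "1.IH" by (auto simp: xs)
    moreover have "weight xs = weight ys + ((1/2) ^ fst y + weight zs)"
      by (simp add: xs)
    then have "(1/2 :: real) ^ fst y < (1/2) ^ n"
      using "1.prems"(2) weight_nonneg[of ys] weight_nonneg[of zs] by linarith
    then have "n < fst y"
      by (simp add: power_strict_decreasing_iff)
    then have "snd y \<in> U (Suc n)"
      using \<open>snd y \<in> U (fst y)\<close> antimono_U[of "Suc n" "fst y"] by auto
    ultimately show ?thesis
      using add_U by (simp add: xs flip: add.assoc)
  qed
qed

definition length_of :: "'a \<Rightarrow> real" where
  "length_of g = Inf {weight xs | xs. chain xs \<and> total xs = g}"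

lemma length_of_le: "chain xs \<Longrightarrow> length_of (total xs) \<le> weight xs"
  unfolding length_of_def
  by (rule cInf_lower) (auto intro!: bdd_belowI[of _ 0] weight_nonneg)

lemma le_length_of: "(\<And>xs. chain xs \<Longrightarrow> total xs = g \<Longrightarrow> r \<le> weight xs) \<Longrightarrow> r \<le> length_of g"
  unfolding length_of_def
  by (rule cInf_greatest) (auto intro!: exI[of _ "[(0, g)]"] simp: chain_def U_0)

lemma length_of_nonneg: "0 \<le> length_of g"
  by (rule le_length_of) (rule weight_nonneg)

lemma length_of_zero: "length_of 0 = 0"
  using length_of_le[of "[]"] length_of_nonneg[of 0] by (simp add: chain_def)

lemma length_of_in_U: "length_of g < (1/2) ^ n \<Longrightarrow> g \<in> U n"
  using le_length_of[of g "(1/2) ^ n"] total_chain_in_U[of _ n] by (metis not_le)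

lemma length_of_le_U: "g \<in> U n \<Longrightarrow> length_of g \<le> (1/2) ^ n"
  using length_of_le[of "[(n, g)]"] by (simp add: chain_def)

lemma length_of_eq_zero: "length_of g = 0 \<Longrightarrow> g = 0"
proof (rule ccontr)
  assume "length_of g = 0" "g \<noteq> 0"
  then obtain S where "open S" "0 \<in> S" "g \<notin> S"
    using hausdorff[of 0 g] by auto
  then obtain n where "g \<notin> U n"
    using U_base by blast
  then show False
    using length_of_in_U[of g n] \<open>length_of g = 0\<close> by simp
qed

text \<open>Concatenated chains have the sum of the weights; the two infima are then taken one after
  the other.\<close>

lemma length_of_add: "length_of (g + h) \<le> length_of g + length_of h"
proof -
  have "length_of (g + h) - weight xs \<le> length_of h" if "chain xs" "total xs = g" for xs
  proof (rule le_length_of)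
    fix ys assume "chain ys" "total ys = h"
    then have "length_of (g + h) \<le> weight xs + weight ys"
      using length_of_le[of "xs @ ys"] that by (auto simp: chain_def)
    then show "length_of (g + h) - weight xs \<le> weight ys"
      by simp
  qed
  then have "length_of (g + h) - length_of h \<le> length_of g"
    by (intro le_length_of) (simp add: algebra_simps)
  then show ?thesis by simp
qed

text \<open>Negating the entries of a chain for \<open>g\<close> and reversing their order, as the
  group need not commute, gives a chain for \<open>- g\<close> of the same weight.\<close>

lemma length_of_uminus_le: "length_of (- g) \<le> length_of g"
proof (rule le_length_of)
  fix xs assume xs: "chain xs" "total xs = g"
  define ys where "ys = rev (map (\<lambda>(n, g). (n, - g)) xs)"
  have "chain ys"
    using xs uminus_U by (auto simp: chain_def ys_def)
  moreover have "total ys = - g"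
    unfolding ys_def xs(2)[symmetric]
    by (induction xs) (auto simp: minus_add diff_conv_add_uminus simp del: add_uminus_conv_diff)
  moreover have "weight ys = weight xs"
    unfolding ys_def by (induction xs) auto
  ultimately show "length_of (- g) \<le> weight xs"
    using length_of_le by metis
qed

lemma metrizable: "metrizable_space (euclidean :: 'a topology)"
proof -
  \<comment> \<open>This distance is left invariant. By \<open>length_of_in_U\<close> and
    \<open>length_of_le_U\<close> its balls at \<open>x\<close> and the left translates of the sets
    \<open>U n\<close> by \<open>x\<close> fit into each other, so it induces the given
    topology.\<close>
  define d where "d x y = length_of (- x + y)" for x y
  interpret Metric_space UNIV d
  proof
    fix x y z
    show "0 \<le> d x y"
      by (simp add: d_def length_of_nonneg)
    show "d x y = 0 \<longleftrightarrow> x = y"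
      using length_of_eq_zero[of "- x + y"]
      by (auto simp: d_def length_of_zero simp flip: neg_eq_iff_add_eq_0)
    have "d x y \<le> d y x" for x y
      using length_of_uminus_le[of "- y + x"] by (simp add: d_def minus_add)
    then show "d x y = d y x"
      by (simp add: antisym)
    show "d x z \<le> d x y + d y z"
      using length_of_add[of "- x + y" "- y + z"] by (simp add: d_def add.assoc)
  qed
  have "open S \<longleftrightarrow> (\<forall>x. x \<in> S \<longrightarrow> (\<exists>r>0. mball x r \<subseteq> S))" for S
  proof (intro iffI allI impI)
    fix x assume "open S" "x \<in> S"
    then obtain n where "U n \<subseteq> {g. x + g \<in> S}"
      using U_base[OF open_translate_vimage(1), of S x] by auto
    then have "mball x ((1/2) ^ n) \<subseteq> S"
      using length_of_in_U[of _ n] by (fastforce simp: d_def subset_iff)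
    then show "\<exists>r>0. mball x r \<subseteq> S"
      by (metis zero_less_power zero_less_divide_1_iff zero_less_numeral)
  next
    assume *: "\<forall>x. x \<in> S \<longrightarrow> (\<exists>r>0. mball x r \<subseteq> S)"
    show "open S"
    proof (subst open_subopen, intro ballI)
      fix x assume "x \<in> S"
      with * obtain r where r: "r > 0" "mball x r \<subseteq> S" by blast
      obtain n where "(1/2) ^ n < r"
        using real_arch_pow_inv[of r "1/2"] r by auto
      then have "{y. - x + y \<in> U n} \<subseteq> S"
        using r(2) length_of_le_U by (force simp: d_def)
      then show "\<exists>T. open T \<and> x \<in> T \<and> T \<subseteq> S"
        using open_translate_vimage(1)[OF open_U, of "- x" n] zero_U
        by (intro exI[of _ "{y. - x + y \<in> U n}"]) auto
    qed
  qed
  then have "mtopology = euclidean"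
    by (simp add: topology_eq openin_mtopology)
  then show ?thesis
    using metrizable_space_mtopology by simp
qed

end

theorem Birkhoff_Kakutani:
  fixes \<B> :: "'a::{topological_group_add, t2_space} set set"
  assumes "countable \<B>" and nhds: "\<And>V. V \<in> \<B> \<Longrightarrow> open V \<and> 0 \<in> V"
    and base: "\<And>S. open S \<Longrightarrow> 0 \<in> S \<Longrightarrow> \<exists>V\<in>\<B>. V \<subseteq> S"
  shows "metrizable_space (euclidean :: 'a topology)"
proof -
  define V where "V = from_nat_into \<B>"
  have "\<B> \<noteq> {}"
    using base[of UNIV] by auto
  then have V: "open (V n)" "0 \<in> V n" for n
    using nhds from_nat_into[of \<B> n] by (auto simp: V_def)
  \<comment> \<open>The recursion starts at \<open>UNIV\<close> and stays inside \<open>V n\<close>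
    at step \<open>Suc n\<close>, so the new sequence is again a base at the unit; the clause for
    \<open>n = 0\<close> carries the start along.\<close>
  have "\<exists>U. \<forall>n. (open (U n) \<and> 0 \<in> U n \<and> (\<forall>x\<in>U n. - x \<in> U n) \<and> (n = 0 \<longrightarrow> U n = UNIV)) \<and>
    (U (Suc n) \<subseteq> V n \<and> (\<forall>x\<in>U (Suc n). \<forall>y\<in>U (Suc n). \<forall>z\<in>U (Suc n). x + y + z \<in> U n))"
  proof (rule dependent_nat_choice)
    fix S :: "'a set" and n :: nat
    assume "open S \<and> 0 \<in> S \<and> (\<forall>x\<in>S. - x \<in> S) \<and> (n = 0 \<longrightarrow> S = UNIV)"
    then obtain W where "open W" "0 \<in> W" "W \<subseteq> S \<inter> V n" "\<And>x. x \<in> W \<Longrightarrow> - x \<in> W"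
      "\<And>x y z. x \<in> W \<Longrightarrow> y \<in> W \<Longrightarrow> z \<in> W \<Longrightarrow> x + y + z \<in> S \<inter> V n"
      using symmetric_nhd[of "S \<inter> V n"] V by (metis IntI open_Int)
    then show "\<exists>T. (open T \<and> 0 \<in> T \<and> (\<forall>x\<in>T. - x \<in> T) \<and> (Suc n = 0 \<longrightarrow> T = UNIV)) \<and>
      (T \<subseteq> V n \<and> (\<forall>x\<in>T. \<forall>y\<in>T. \<forall>z\<in>T. x + y + z \<in> S))"
      by (intro exI[of _ W]) auto
  qed (auto intro!: exI[of _ UNIV])
  then obtain U where U: "\<And>n. open (U n)" "\<And>n. 0 \<in> U n" "\<And>n x. x \<in> U n \<Longrightarrow> - x \<in> U n"
    "U 0 = UNIV" "\<And>n. U (Suc n) \<subseteq> V n"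
    "\<And>n x y z. x \<in> U (Suc n) \<Longrightarrow> y \<in> U (Suc n) \<Longrightarrow> z \<in> U (Suc n) \<Longrightarrow> x + y + z \<in> U n"
    by metis
  interpret halving_nhds U
  proof
    fix S :: "'a set" assume "open S" "0 \<in> S"
    then obtain n where "V n \<subseteq> S"
      using base from_nat_into_surj[OF \<open>countable \<B>\<close>] unfolding V_def by metis
    then show "\<exists>n. U n \<subseteq> S"
      using U(5) by blast
  qed (use U in auto)
  show ?thesis by (rule metrizable)
qed

section \<open>The strong Pytkeev property implies metrizability\<close>

text \<open>
  If no finite union of members covers \<open>V\<close> by finitely many translates, one picks
  \<open>x k \<in> V\<close> outside the first \<open>k\<close> translates of the first \<open>k\<close> members. Precompactness makes the
  differences \<open>- x i + x j\<close> accumulate at \<open>0\<close>, while each member contains only finitely many.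
\<close>

lemma Pytkeev_finite_translates:
  fixes V :: "'a::topological_group_add set"
  assumes "countable \<D>"
    and Pytkeev: "\<And>U A. open U \<Longrightarrow> 0 \<in> U \<Longrightarrow> 0 \<in> closure A - A \<Longrightarrow> \<exists>D\<in>\<D>. D \<subseteq> U \<and> infinite (D \<inter> A)"
    and "precompact V" "open U" "0 \<in> U"
  obtains \<E> F where "finite \<E>" "\<E> \<subseteq> insert {0} \<D>" "\<Union>\<E> \<subseteq> U" "finite F" "V \<subseteq> F + \<Union>\<E>"
proof (rule ccontr)
  assume "\<not> thesis"
  note no_cover = that
  have none: "\<not> V \<subseteq> F + \<Union>\<E>"
    if "finite \<E>" "\<E> \<subseteq> insert {0} \<D>" "\<Union>\<E> \<subseteq> U" "finite F" for \<E> F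
    using no_cover[OF that] \<open>\<not> thesis\<close> by blast
  \<comment> \<open>The set \<open>{0}\<close> makes this family nonempty, so that it can be
    enumerated.\<close>
  define \<D>' where "\<D>' = {D \<in> insert {0} \<D>. D \<subseteq> U}"
  define e where "e = from_nat_into \<D>'"
  have \<D>': "countable \<D>'" "\<D>' \<noteq> {}"
    using assms countable_subset[of \<D>' "insert {0} \<D>"] by (auto simp: \<D>'_def)
  have e: "e n \<in> \<D>'" for n
    unfolding e_def using \<D>' by (simp add: from_nat_into)
  \<comment> \<open>Since 0 lies in every \<open>E k\<close>, each \<open>x k\<close> chosen below
    differs from all earlier ones, and 0 is not among the differences in \<open>A\<close>.\<close>
  define E where "E k = \<Union>(insert {0} (e ` {..k}))" for k
  have E: "finite (insert {0} (e ` {..k}))" "insert {0} (e ` {..k}) \<subseteq> insert {0} \<D>" "E k \<subseteq> U" for k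
    using e \<open>0 \<in> U\<close> by (auto simp: \<D>'_def E_def)
  have "\<exists>x. \<forall>k::nat. x k \<in> V \<and> x k \<notin> x ` {..<k} + E k"
  proof (rule dependent_wellorder_choice)
    fix r k and f g :: "nat \<Rightarrow> 'a"
    assume "\<And>i. i < k \<Longrightarrow> f i = g i"
    then have "f ` {..<k} = g ` {..<k}" by (intro image_cong) auto
    then show "(r \<in> V \<and> r \<notin> f ` {..<k} + E k) = (r \<in> V \<and> r \<notin> g ` {..<k} + E k)" by simp
  next
    fix k and f :: "nat \<Rightarrow> 'a"
    show "\<exists>r. r \<in> V \<and> r \<notin> f ` {..<k} + E k"
      using none[OF E(1,2)[of k] E(3)[of k, unfolded E_def], of "f ` {..<k}"]
      unfolding E_def[symmetric] by blast
  qed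
  then obtain x where x: "\<And>k::nat. x k \<in> V" "\<And>k. x k \<notin> x ` {..<k} + E k"
    by blast
  have diff_notin_E: "- x i + x j \<notin> E j" if "i < j" for i j
  proof
    assume "- x i + x j \<in> E j"
    then have "x i + (- x i + x j) \<in> x ` {..<j} + E j"
      using that by (intro set_plus_intro) auto
    then show False using x(2) by simp
  qed
  define A where "A = {- x i + x j | i j. i < j}"
  have "0 \<notin> A"
    using diff_notin_E by (auto simp: A_def E_def)
  moreover have "0 \<in> closure A"
    unfolding closure_iff_nhds_not_empty
  proof (intro allI impI)
    fix S T :: "'a set" assume "T \<subseteq> S" "open T" "0 \<in> T"
    obtain W where W: "open W" "0 \<in> W" "\<And>x. x \<in> W \<Longrightarrow> - x \<in> W"
      "\<And>x y. x \<in> W \<Longrightarrow> y \<in> W \<Longrightarrow> x + y \<in> T"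
      using symmetric_nhd[OF \<open>open T\<close> \<open>0 \<in> T\<close>] by metis
    obtain F where F: "finite F" "V \<subseteq> F + W"
      using \<open>precompact V\<close>[unfolded precompact_def, rule_format, OF conjI[OF W(1,2)]] by metis
    have "\<exists>c. c \<in> F \<and> - c + x k \<in> W" for k
    proof -
      obtain c w where "c \<in> F" "w \<in> W" "x k = c + w"
        using x(1)[of k] F(2) by (auto simp: set_plus_def)
      then show ?thesis by auto
    qed
    then obtain c where c: "\<And>k. c k \<in> F" "\<And>k. - c k + x k \<in> W"
      by metis
    have "\<not> inj c"
      using F(1) c(1) finite_subset[of "range c" F] finite_imageD[of c UNIV] by auto
    then obtain i j where "i < j" "c i = c j"
      unfolding inj_def by (metis linorder_neq_iff)
    have "- (- c i + x i) + (- c j + x j) \<in> T"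
      using W c by blast
    then have "- x i + x j \<in> T"
      using \<open>c i = c j\<close> by (simp add: add_assoc_minus_add)
    then show "A \<inter> S \<noteq> {}"
      using \<open>i < j\<close> \<open>T \<subseteq> S\<close> by (auto simp: A_def)
  qed
  ultimately obtain D where D: "D \<in> \<D>" "D \<subseteq> U" "infinite (D \<inter> A)"
    using Pytkeev[OF \<open>open U\<close> \<open>0 \<in> U\<close>, of A] by auto
  then obtain k where k: "D = e k"
    using from_nat_into_surj[OF \<D>'(1), of D] by (auto simp: \<D>'_def e_def)
  \<comment> \<open>As \<open>e k\<close> is part of \<open>E j\<close> for all
    \<open>j \<ge> k\<close>, no difference \<open>- x i + x j\<close> with \<open>i < j\<close> and
    \<open>j \<ge> k\<close> lies in \<open>D\<close>; finitely many pairs remain.\<close>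
  have "D \<inter> A \<subseteq> (\<lambda>(i, j). - x i + x j) ` ({..k} \<times> {..k})"
  proof
    fix a assume "a \<in> D \<inter> A"
    then obtain i j where ij: "i < j" "a = - x i + x j" "a \<in> e k"
      by (auto simp: A_def k)
    then have "j \<le> k"
      using diff_notin_E[OF ij(1)] by (force simp: E_def)
    then show "a \<in> (\<lambda>(i, j). - x i + x j) ` ({..k} \<times> {..k})"
      using ij by auto
  qed
  then show False
    using D(3) finite_subset by blast
qed

lemma minus_add_in_closure:
  fixes E :: "'a::topological_group_add set"
  assumes "p \<in> closure E" "q \<in> closure E"
  shows "- p + q \<in> closure {- a + b | a b. a \<in> E \<and> b \<in> E}"
  unfolding closure_iff_nhds_not_empty
proof (intro allI impI)
  fix S T :: "'a set" assume "T \<subseteq> S" "open T" "- p + q \<in> T"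
  then obtain A B where AB: "open A" "open B" "- p \<in> A" "q \<in> B"
    "\<And>x y. x \<in> A \<Longrightarrow> y \<in> B \<Longrightarrow> x + y \<in> T"
    using add_nhds[of T "- p" q] by auto
  obtain a where "a \<in> E" "- a \<in> A"
    using open_Int_closure_eq_empty[OF open_uminus_vimage[OF AB(1)], of E] assms(1) AB(3) by blast
  moreover obtain b where "b \<in> E" "b \<in> B"
    using open_Int_closure_eq_empty[OF AB(2), of E] assms(2) AB(4) by blast
  ultimately show "{- a + b | a b. a \<in> E \<and> b \<in> E} \<inter> S \<noteq> {}"
    using AB(5) \<open>T \<subseteq> S\<close> by blast
qed

text \<open>A finite substitute for Baire category, valid in every space: adjoining a set with empty
  interior to a closed set does not change the interior of the latter.\<close>

lemma finite_Union_closed_interior: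
  assumes "finite \<F>" "\<And>C. C \<in> \<F> \<Longrightarrow> closed C" "interior (\<Union>\<F>) \<noteq> {}"
  obtains C where "C \<in> \<F>" "interior C \<noteq> {}"
  using assms
proof (induction \<F> arbitrary: thesis rule: finite_induct)
  case (insert C \<F>)
  then show ?case
    using interior_closed_Un_empty_interior[of C "\<Union>\<F>"] by (metis Union_insert insert_iff)
qed simp

text \<open>Finitely many closed translates of \<open>closure E\<close> cover \<open>V\<close>, so
  one of them contains an open set \<open>S\<close> around some \<open>p\<close>. The neighbourhood
  \<open>- p + S\<close> of 0 then consists of differences of points of
  \<open>closure E\<close>.\<close>

lemma zero_in_interior_closure_differences:
  fixes E :: "'a::topological_group_add set"
  assumes "finite F" "V \<subseteq> F + E" "interior V \<noteq> {}"
  shows "0 \<in> interior (closure {- a + b | a b. a \<in> E \<and> b \<in> E})"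
proof -
  \<comment> \<open>This is the translate of \<open>closure E\<close> by \<open>f\<close>, written
    as a preimage so that it is closed by continuity.\<close>
  define T where "T f = {x. - f + x \<in> closure E}" for f
  have "closed (T f)" for f
    using closed_vimage[OF closed_closure, of "\<lambda>x. - f + x" E]
    by (simp add: T_def vimage_def continuous_intros)
  moreover have "V \<subseteq> \<Union>(T ` F)"
    using assms(2) closure_subset[of E] by (force simp: T_def set_plus_def)
  then have "interior (\<Union>(T ` F)) \<noteq> {}"
    using assms(3) interior_mono by blast
  ultimately obtain f where "interior (T f) \<noteq> {}"
    using finite_Union_closed_interior[of "T ` F"] assms(1) by (metis finite_imageI imageE)
  then obtain S p where S: "open S" "p \<in> S" "S \<subseteq> T f"
    by (auto simp: interior_def)
  have "{x. p + x \<in> S} \<subseteq> closure {- a + b | a b. a \<in> E \<and> b \<in> E}"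
  proof
    fix x assume "x \<in> {x. p + x \<in> S}"
    then have "- f + p \<in> closure E" "- f + (p + x) \<in> closure E"
      using S by (auto simp: T_def)
    then show "x \<in> closure {- a + b | a b. a \<in> E \<and> b \<in> E}"
      using minus_add_in_closure[of "- f + p" E "- f + (p + x)"] by (simp add: add_assoc_minus_add)
  qed
  then show ?thesis
    using S open_translate_vimage(1)[OF S(1), of p] by (auto intro: interiorI)
qed

lemma strong_Pytkeev_imp_metrizable:
  fixes V :: "'a::{topological_group_add, t2_space} set"
  assumes "precompact V" "interior V \<noteq> {}" "strong_Pytkeev (euclidean :: 'a topology)"
  shows "metrizable_space (euclidean :: 'a topology)"
proof -
  have "\<exists>\<D> :: 'a set set. countable \<D> \<and>
    (\<forall>U A. open U \<and> 0 \<in> U \<and> 0 \<in> closure A \<and> 0 \<notin> A \<longrightarrow> (\<exists>D\<in>\<D>. D \<subseteq> U \<and> infinite (D \<inter> A)))"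
    using assms(3) by (simp add: strong_Pytkeev_def)
  then obtain \<D> :: "'a set set" where "countable \<D>" and Pytkeev:
    "\<And>U A. open U \<Longrightarrow> 0 \<in> U \<Longrightarrow> 0 \<in> closure A - A \<Longrightarrow> \<exists>D\<in>\<D>. D \<subseteq> U \<and> infinite (D \<inter> A)"
    by blast
  define Q where "Q \<E> = interior (closure {- a + b | a b. a \<in> \<Union>\<E> \<and> b \<in> \<Union>\<E>})"
    for \<E> :: "'a set set"
  define \<B> where "\<B> = Q ` {\<E>. finite \<E> \<and> \<E> \<subseteq> insert {0} \<D> \<and> 0 \<in> Q \<E>}"
  show ?thesis
  proof (rule Birkhoff_Kakutani)
    have "countable {\<E>. finite \<E> \<and> \<E> \<subseteq> insert {0} \<D>}"
      using \<open>countable \<D>\<close> by (intro countable_Collect_finite_subset) auto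
    then show "countable \<B>"
      unfolding \<B>_def by (rule countable_image[OF countable_subset, rotated]) auto
    show "open S \<and> 0 \<in> S" if "S \<in> \<B>" for S
      using that by (auto simp: \<B>_def Q_def)
    fix S :: "'a set" assume "open S" "0 \<in> S"
    then obtain W where W: "open W" "0 \<in> W" "\<And>x. x \<in> W \<Longrightarrow> - x \<in> W"
      "\<And>x y z. x \<in> W \<Longrightarrow> y \<in> W \<Longrightarrow> z \<in> W \<Longrightarrow> x + y + z \<in> S"
      using symmetric_nhd by metis
    obtain \<E> F where \<E>: "finite \<E>" "\<E> \<subseteq> insert {0} \<D>" "\<Union>\<E> \<subseteq> W" "finite F" "V \<subseteq> F + \<Union>\<E>"
      using Pytkeev_finite_translates[OF \<open>countable \<D>\<close> _ assms(1) W(1,2)] Pytkeev by metis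
    have "Q \<E> \<in> \<B>"
      unfolding \<B>_def using \<E> zero_in_interior_closure_differences[OF \<E>(4,5) assms(2)]
      by (auto simp: Q_def)
    moreover have "Q \<E> \<subseteq> S"
    proof
      fix z assume "z \<in> Q \<E>"
      then have "z \<in> closure {- a + b | a b. a \<in> \<Union>\<E> \<and> b \<in> \<Union>\<E>}"
        using interior_subset by (auto simp: Q_def)
      \<comment> \<open>Two of the three summands from \<open>W\<close> account for the difference
        \<open>- a + b\<close>; the third pays for passing from the closure back to the set of
        differences.\<close>
      moreover have "open {y. - z + y \<in> W}" "z \<in> {y. - z + y \<in> W}"
        using W open_translate_vimage by auto
      ultimately have "{- a + b | a b. a \<in> \<Union>\<E> \<and> b \<in> \<Union>\<E>} \<inter> {y. - z + y \<in> W} \<noteq> {}"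
        unfolding closure_iff_nhds_not_empty by blast
      then obtain a b where "a \<in> \<Union>\<E>" "b \<in> \<Union>\<E>" "- z + (- a + b) \<in> W"
        by blast
      then have "- a + b + - (- z + (- a + b)) \<in> S"
        using W \<E>(3) by (meson subsetD)
      then show "z \<in> S"
        by (simp add: add_assoc_minus_add)
    qed
    ultimately show "\<exists>V\<in>\<B>. V \<subseteq> S" by blast
  qed
qed

section \<open>The cp-network of a metrizable group\<close>

text \<open>For the whole group this is the property known as omega-narrow or
  aleph_0-bounded.\<close>

definition sigma_bounded :: "'a::topological_group_add set \<Rightarrow> bool" where
  "sigma_bounded E \<longleftrightarrow> (\<forall>W. open W \<and> 0 \<in> W \<longrightarrow> (\<exists>C. countable C \<and> E \<subseteq> C + W))"

lemma sigma_bounded_UN: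
  fixes E :: "nat \<Rightarrow> 'a::topological_group_add set"
  assumes "\<And>n. sigma_bounded (E n)"
  shows "sigma_bounded (\<Union>n. E n)"
  unfolding sigma_bounded_def
proof (intro allI impI)
  fix W :: "'a set" assume "open W \<and> 0 \<in> W"
  then have "\<forall>n. \<exists>C. countable C \<and> E n \<subseteq> C + W"
    using assms unfolding sigma_bounded_def by blast
  then obtain C where C: "\<And>n. countable (C n)" "\<And>n. E n \<subseteq> C n + W"
    by metis
  have "(\<Union>n. E n) \<subseteq> (\<Union>n. C n) + W"
    using C(2) by (fastforce simp: set_plus_def)
  then show "\<exists>C. countable C \<and> (\<Union>n. E n) \<subseteq> C + W"
    using C(1) by (intro exI[of _ "\<Union>n. C n"]) auto
qed

text \<open>Without commutativity, an error \<open>w\<close> in \<open>v = f + w\<close> must be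
  moved past the centre \<open>c\<close> of the second summand. Hence \<open>V\<close> is covered
  anew for each \<open>c\<close>, using the conjugate neighbourhood of those \<open>w\<close> with
  \<open>- c + w + c\<close> in \<open>T\<close>; then \<open>f + c\<close> serves as the new
  centre.\<close>

lemma sigma_bounded_plus:
  fixes V E :: "'a::topological_group_add set"
  assumes "precompact V" "sigma_bounded E"
  shows "sigma_bounded (V + E)"
  unfolding sigma_bounded_def
proof (intro allI impI)
  fix W :: "'a set" assume "open W \<and> 0 \<in> W"
  then obtain T where T: "open T" "0 \<in> T" "\<And>x y. x \<in> T \<Longrightarrow> y \<in> T \<Longrightarrow> x + y \<in> W"
    using symmetric_nhd by metis
  obtain C where C: "countable C" "E \<subseteq> C + T"
    using T assms(2) unfolding sigma_bounded_def by blast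
  have "\<exists>F. finite F \<and> V \<subseteq> F + {w. - c + (w + c) \<in> T}" for c
  proof -
    have "open {w. - c + (w + c) \<in> T}"
      using open_translate_vimage(2)[OF open_translate_vimage(1)[OF T(1)], of c "- c"] by simp
    then show ?thesis
      using assms(1) T(2) unfolding precompact_def by auto
  qed
  then obtain F where F: "\<And>c. finite (F c)" "\<And>c. V \<subseteq> F c + {w. - c + (w + c) \<in> T}"
    by metis
  define C' where "C' = (\<Union>c\<in>C. (\<lambda>f. f + c) ` F c)"
  have "V + E \<subseteq> C' + W"
  proof
    fix z assume "z \<in> V + E"
    then obtain v c t where z: "z = v + (c + t)" "v \<in> V" "c \<in> C" "t \<in> T"
      using C(2) by (fastforce simp: set_plus_def)
    then obtain f w where w: "v = f + w" "f \<in> F c" "- c + (w + c) \<in> T"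
      using F(2)[of c] by (auto simp: set_plus_def)
    have "z = (f + c) + ((- c + (w + c)) + t)"
      by (simp add: z w add_assoc_minus_add)
    moreover have "f + c \<in> C'"
      using w z by (auto simp: C'_def)
    ultimately show "z \<in> C' + W"
      using T(3) w z by blast
  qed
  moreover have "countable C'"
    unfolding C'_def using C(1) F(1) by (simp add: countable_finite)
  ultimately show "\<exists>C. countable C \<and> V + E \<subseteq> C + W" by blast
qed

text \<open>The subgroup generated by \<open>V\<close> works. Symmetry of \<open>V\<close> lets
  finite sums exhaust it, it contains a translate of \<open>interior V\<close> around each of its
  points, and it is the union of the \<open>k\<close>-fold sums of \<open>V\<close>, which are
  handled by induction on \<open>k\<close>.\<close>

lemma sigma_bounded_open_subgroup:
  fixes V :: "'a::topological_group_add set"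
  assumes "precompact V" "uminus ` V = V" "0 \<in> interior V"
  obtains H :: "'a set" where "open H" "0 \<in> H" "\<And>x. x \<in> H \<Longrightarrow> - x \<in> H"
    "\<And>x y. x \<in> H \<Longrightarrow> y \<in> H \<Longrightarrow> x + y \<in> H" "sigma_bounded H"
proof -
  define L where "L k = sum_list ` {xs. set xs \<subseteq> V \<and> length xs = k}" for k
  define H where "H = (\<Union>k. L k)"
  have H_iff: "x \<in> H \<longleftrightarrow> (\<exists>xs. set xs \<subseteq> V \<and> x = sum_list xs)" for x
    by (auto simp: H_def L_def)
  have H_add: "x + y \<in> H" if xy: "x \<in> H" "y \<in> H" for x y
  proof -
    obtain xs ys where "set xs \<subseteq> V" "x = sum_list xs" "set ys \<subseteq> V" "y = sum_list ys"
      using xy H_iff by auto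
    then show ?thesis
      unfolding H_iff by (intro exI[of _ "xs @ ys"]) auto
  qed
  have V_H: "V \<subseteq> H"
    unfolding subset_iff H_iff by (auto intro!: exI[of _ "[_]"])
  show thesis
  proof (rule that)
    show "0 \<in> H"
      unfolding H_iff by (auto intro!: exI[of _ "[]"])
    show "- x \<in> H" if x: "x \<in> H" for x
    proof -
      obtain xs where xs: "set xs \<subseteq> V" "x = sum_list xs"
        using x H_iff by auto
      have "- sum_list xs \<in> H"
        using xs(1)
      proof (induction xs)
        case Nil
        then show ?case using \<open>0 \<in> H\<close> by simp
      next
        case (Cons v xs)
        have "- v \<in> H"
          using Cons.prems V_H assms(2) by auto
        then show ?case
          using Cons H_add[of "- sum_list xs" "- v"] by (simp add: minus_add)
      qed
      with xs show ?thesis by simp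
    qed
    show "open H"
    proof (subst open_subopen, intro ballI exI conjI)
      fix x assume "x \<in> H"
      show "open {y. - x + y \<in> interior V}"
        by (rule open_translate_vimage) simp
      show "x \<in> {y. - x + y \<in> interior V}"
        using assms(3) by simp
      show "{y. - x + y \<in> interior V} \<subseteq> H"
      proof
        fix y assume "y \<in> {y. - x + y \<in> interior V}"
        then have "- x + y \<in> H"
          using V_H interior_subset by blast
        then show "y \<in> H"
          using H_add[OF \<open>x \<in> H\<close>, of "- x + y"] by simp
      qed
    qed
    have "sigma_bounded (L k)" for k
    proof (induction k)
      case 0
      have "{0} \<subseteq> {0} + W" if "0 \<in> W" for W :: "'a set"
        using that by (auto simp: set_plus_def)
      then show ?case
        by (auto simp: sigma_bounded_def L_def intro!: exI[of _ "{0}"])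
    next
      case (Suc k)
      have "L (Suc k) = V + L k"
      proof (intro equalityI subsetI)
        fix z assume "z \<in> L (Suc k)"
        then obtain v xs where "z = v + sum_list xs" "v \<in> V" "set xs \<subseteq> V" "length xs = k"
          by (auto simp: L_def length_Suc_conv)
        then show "z \<in> V + L k"
          unfolding L_def by blast
      next
        fix z assume "z \<in> V + L k"
        then obtain v xs where "z = v + sum_list xs" "v \<in> V" "set xs \<subseteq> V" "length xs = k"
          by (auto simp: L_def set_plus_def)
        then show "z \<in> L (Suc k)"
          unfolding L_def by (intro image_eqI[of _ _ "v # xs"]) auto
      qed
      then show ?case
        using sigma_bounded_plus[OF assms(1) Suc] by simp
    qed
    then show "sigma_bounded H"
      unfolding H_def by (rule sigma_bounded_UN)
  qed (rule H_add)
qed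

text \<open>\<open>R\<close> meets each left coset of \<open>H\<close> at most once, so the
  translates of \<open>B\<close> by elements of \<open>R\<close> lie in different cosets. The open
  coset of \<open>x\<close> therefore meets at most one of them.\<close>

lemma locally_finite_in_coset_translates:
  fixes H :: "'a::topological_group_add set"
  assumes "open H" "0 \<in> H" and H_uminus: "\<And>x. x \<in> H \<Longrightarrow> - x \<in> H"
    and H_add: "\<And>x y. x \<in> H \<Longrightarrow> y \<in> H \<Longrightarrow> x + y \<in> H"
    and R: "\<And>r s. r \<in> R \<Longrightarrow> s \<in> R \<Longrightarrow> - r + s \<in> H \<Longrightarrow> r = s"
    and "B \<subseteq> H"
  shows "locally_finite_in euclidean ((\<lambda>r. {x. - r + x \<in> B}) ` R)"
  unfolding locally_finite_in_def
proof (intro conjI ballI)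
  fix x :: 'a
  define \<N> where "\<N> = {N \<in> (\<lambda>r. {x. - r + x \<in> B}) ` R. N \<inter> {y. - x + y \<in> H} \<noteq> {}}"
  have key: "- r + s \<in> H" if "- r + y \<in> H" "- s + y \<in> H" for r s y
    using H_add[OF that(1) H_uminus[OF that(2)]] by (simp add: add_assoc_minus_add)
  have "N = M" if NM: "N \<in> \<N>" "M \<in> \<N>" for N M
  proof -
    obtain r y where r: "N = {x. - r + x \<in> B}" "r \<in> R" "- r + y \<in> B" "- x + y \<in> H"
      using NM(1) by (auto simp: \<N>_def)
    obtain s z where s: "M = {x. - s + x \<in> B}" "s \<in> R" "- s + z \<in> B" "- x + z \<in> H"
      using NM(2) by (auto simp: \<N>_def)
    have "- r + x \<in> H" "- s + x \<in> H"
      using key r s \<open>B \<subseteq> H\<close> by blast+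
    then have "r = s"
      using R r(2) s(2) key by blast
    then show ?thesis using r(1) s(1) by simp
  qed
  then have "finite \<N>"
    by (metis (no_types, lifting) finite.simps insertCI is_singletonI' is_singleton_def)
  then show "\<exists>V. openin euclidean V \<and> x \<in> V \<and>
      finite {N \<in> (\<lambda>r. {x. - r + x \<in> B}) ` R. N \<inter> V \<noteq> {}}"
    unfolding \<N>_def using assms(1,2) open_translate_vimage
    by (intro exI[of _ "{y. - x + y \<in> H}"]) auto
qed simp

text \<open>If an open set around an accumulation point \<open>x\<close> of \<open>A\<close> met
  \<open>A\<close> in a finite set, removing that closed set would leave a neighbourhood of
  \<open>x\<close> missing \<open>A\<close>.\<close>

lemma cp_network_if_open_base:
  fixes \<N> :: "'a::t1_space set set"
  assumes "\<And>x U. open U \<Longrightarrow> x \<in> U \<Longrightarrow> \<exists>N\<in>\<N>. open N \<and> x \<in> N \<and> N \<subseteq> U"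
  shows "cp_network euclidean \<N>"
proof -
  have "infinite (N \<inter> A)" if "open N" "x \<in> N" "x \<in> closure A - A" for N A and x :: 'a
  proof
    assume "finite (N \<inter> A)"
    then have "open (N - N \<inter> A)" "x \<in> N - N \<inter> A"
      using that by (auto intro!: open_Diff finite_imp_closed)
    moreover have "A \<inter> (N - N \<inter> A) = {}" by blast
    ultimately show False
      using that(3) open_Int_closure_eq_empty[of "N - N \<inter> A" A] by blast
  qed
  then show ?thesis
    unfolding cp_network_def cp_network_at_def using assms
    by (simp add: subset_iff) metis
qed

lemma metrizable_imp_P_space:
  fixes V :: "'a::{topological_group_add, t2_space} set"
  assumes "precompact V" "uminus ` V = V" "0 \<in> interior V"
    and metr: "metrizable_space (euclidean :: 'a topology)"
  shows "P_space (euclidean :: 'a topology)"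
proof -
  obtain H :: "'a set" where H: "open H" "0 \<in> H" and H_uminus: "\<And>x. x \<in> H \<Longrightarrow> - x \<in> H"
    and H_add: "\<And>x y. x \<in> H \<Longrightarrow> y \<in> H \<Longrightarrow> x + y \<in> H" and "sigma_bounded H"
    using sigma_bounded_open_subgroup[OF assms(1-3)] by metis
  have "\<exists>\<B> :: 'a set set. countable \<B> \<and> (\<forall>S\<in>\<B>. open S) \<and>
      (\<forall>S. open S \<and> 0 \<in> S \<longrightarrow> (\<exists>T\<in>\<B>. 0 \<in> T \<and> T \<subseteq> S))"
    using metrizable_imp_first_countable[OF metr] by (simp add: first_countable_def)
  then obtain \<B> :: "'a set set" where \<B>: "countable \<B>" "\<forall>S\<in>\<B>. open S"
      "\<forall>S. open S \<and> 0 \<in> S \<longrightarrow> (\<exists>T\<in>\<B>. 0 \<in> T \<and> T \<subseteq> S)"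
    by (elim exE conjE)
  define \<B>0 where "\<B>0 = {S \<in> \<B>. 0 \<in> S}"
  define W where "W = from_nat_into \<B>0"
  have \<B>0: "countable \<B>0" "\<B>0 \<noteq> {}"
    using \<B>(1) \<B>(3)[rule_format, of UNIV] by (auto simp: \<B>0_def)
  then have W: "open (W m)" "0 \<in> W m" for m
    using from_nat_into[of \<B>0 m] \<B>(2) by (auto simp: W_def \<B>0_def)
  have W_base: "\<exists>m. W m \<subseteq> S" if "open S" "0 \<in> S" for S
    using \<B>(3)[rule_format, OF conjI[OF that]] from_nat_into_surj[OF \<B>0(1)] unfolding W_def \<B>0_def
    by (metis (no_types, lifting) mem_Collect_eq)
  have "\<forall>m. \<exists>C. countable C \<and> H \<subseteq> C + W m"
    using \<open>sigma_bounded H\<close> W unfolding sigma_bounded_def by blast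
  then obtain C where C: "\<And>m. countable (C m)" "\<And>m. H \<subseteq> C m + W m"
    by metis
  \<comment> \<open>One representative per left coset of \<open>H\<close>: the condition under
    \<open>SOME\<close> depends only on the coset of \<open>x\<close>.\<close>
  define rep where "rep x = (SOME y. - x + y \<in> H)" for x
  have rep: "- x + rep x \<in> H" for x
    unfolding rep_def by (rule someI[of _ x]) (simp add: H)
  have rep_eq: "rep x = rep y" if "- x + y \<in> H" for x y
  proof -
    have "- x + z \<in> H \<longleftrightarrow> - y + z \<in> H" for z
    proof
      assume "- x + z \<in> H"
      then show "- y + z \<in> H"
        using H_add[OF H_uminus[OF that], of "- x + z"] by (simp add: add_assoc_minus_add)
    next
      assume "- y + z \<in> H"
      then show "- x + z \<in> H"
        using H_add[OF that, of "- y + z"] by (simp add: add_assoc_minus_add)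
    qed
    then show ?thesis by (simp add: rep_def)
  qed
  \<comment> \<open>This is the part of \<open>c + W m\<close> inside \<open>H\<close>, translated
    by \<open>r\<close>. For fixed \<open>m\<close> and \<open>c\<close>, letting \<open>r\<close>
    run through the representatives copies it to every coset; countably many pairs of
    \<open>m\<close> and \<open>c\<close> suffice.\<close>
  define N where "N m c r = {x. - r + x \<in> H \<inter> {h. - c + h \<in> W m}}" for m c r
  define \<A> where "\<A> = (\<lambda>(m, i). N m (from_nat_into (C m) i) ` range rep)"
  have lf: "locally_finite_in euclidean (\<A> (m, i))" for m i
    unfolding \<A>_def N_def prod.case
  proof (rule locally_finite_in_coset_translates[where H = H])
    fix r s assume "r \<in> range rep" "s \<in> range rep" "- r + s \<in> H"
    moreover have "rep (rep x) = rep x" for x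
      using rep_eq[OF rep] by simp
    ultimately show "r = s"
      using rep_eq by force
  qed (use H H_uminus H_add in auto)
  have "sigma_locally_finite_in euclidean (\<Union>n. \<A> (prod_decode n))"
    unfolding sigma_locally_finite_in_def
    using lf by (intro exI[of _ "\<lambda>n. \<A> (prod_decode n)"]) (metis surj_pair)
  moreover have "cp_network euclidean (\<Union>n. \<A> (prod_decode n))"
  proof (rule cp_network_if_open_base)
    fix x and U :: "'a set" assume "open U" "x \<in> U"
    then have "open {g. x + g \<in> U}" "0 \<in> {g. x + g \<in> U}"
      using open_translate_vimage by auto
    then obtain S where S: "open S" "0 \<in> S" "\<And>s. s \<in> S \<Longrightarrow> - s \<in> S"
      "\<And>s t. s \<in> S \<Longrightarrow> t \<in> S \<Longrightarrow> s + t \<in> {g. x + g \<in> U}"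
      using symmetric_nhd by metis
    obtain m where m: "W m \<subseteq> S"
      using W_base S by blast
    define r where "r = rep x"
    have rx: "- r + x \<in> H"
      using H_uminus[OF rep[of x]] by (simp add: r_def minus_add)
    then obtain c w where c: "c \<in> C m" "w \<in> W m" "- r + x = c + w"
      using C(2)[of m] by (auto simp: set_plus_def)
    then obtain i where i: "c = from_nat_into (C m) i"
      using from_nat_into_surj[OF C(1)] by metis
    have "N m c r \<in> \<A> (prod_decode (prod_encode (m, i)))"
      by (auto simp: \<A>_def i r_def)
    moreover have "open (N m c r)"
      unfolding N_def using H W open_translate_vimage by (intro open_translate_vimage open_Int) auto
    moreover have "x \<in> N m c r"
      using rx c by (simp add: N_def)
    moreover have "N m c r \<subseteq> U"
    \<comment> \<open>Both \<open>x\<close> and \<open>y\<close> lie in the translate of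
      \<open>W m\<close> by \<open>r + c\<close>, so \<open>- x + y\<close> has the form
      \<open>- w + w'\<close> with \<open>w\<close> and \<open>w'\<close> in
      \<open>S\<close>.\<close>
    proof
      fix y assume "y \<in> N m c r"
      then have y: "- c + (- r + y) \<in> S"
        using m by (auto simp: N_def)
      have "w = - c + (- r + x)"
        using c(3) by simp
      then have "- (- c + (- r + x)) + (- c + (- r + y)) \<in> {g. x + g \<in> U}"
        using S(3,4) y c(2) m by blast
      then show "y \<in> U"
        by (simp add: add_assoc_minus_add)
    qed
    ultimately show "\<exists>N\<in>\<Union>n. \<A> (prod_decode n). open N \<and> x \<in> N \<and> N \<subseteq> U"
      by blast
  qed
  ultimately show ?thesis
    unfolding P_space_def
    using metrizable_imp_Hausdorff_space[OF metr] metrizable_imp_regular_space[OF metr] by blast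
qed

section \<open>The strong Pytkeev property of P-spaces, and the equivalence\<close>

lemma P_space_imp_strong_Pytkeev:
  assumes "P_space X"
  shows "strong_Pytkeev X"
proof -
  obtain \<N> \<A> where \<N>: "cp_network X \<N>" and \<A>: "\<And>n::nat. locally_finite_in X (\<A> n)" "\<N> = (\<Union>n. \<A> n)"
    using assms unfolding P_space_def sigma_locally_finite_in_def by blast
  show ?thesis
    unfolding strong_Pytkeev_def
  proof (intro ballI exI conjI allI impI)
    fix x assume x: "x \<in> topspace X"
    let ?\<D> = "{N \<in> \<N>. x \<in> N}"
    have "finite {N \<in> \<A> n. x \<in> N}" for n
    proof -
      obtain V where "x \<in> V" "finite {N \<in> \<A> n. N \<inter> V \<noteq> {}}"
        using \<A>(1)[of n] x unfolding locally_finite_in_def by blast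
      then show ?thesis
        by (elim rev_finite_subset) auto
    qed
    moreover have "?\<D> = (\<Union>n. {N \<in> \<A> n. x \<in> N})"
      using \<A>(2) by blast
    ultimately show "countable ?\<D>"
      by (simp add: countable_finite)
    show "?\<D> \<subseteq> Pow (topspace X)"
      using \<N> by (auto simp: cp_network_def)
    fix U A
    assume *: "openin X U \<and> x \<in> U \<and> A \<subseteq> topspace X \<and> x \<in> X closure_of A - A"
    \<comment> \<open>This rules out the first alternative of \<open>cp_network_at\<close>.\<close>
    then have "\<not> openin X {x}"
      by (auto simp: in_closure_of)
    then have "\<exists>N\<in>\<N>. x \<in> N \<and> N \<subseteq> U \<and> infinite (N \<inter> A)"
      using \<N> x * unfolding cp_network_def cp_network_at_def by blast
    then show "\<exists>D\<in>?\<D>. D \<subseteq> U \<and> infinite (D \<inter> A)"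
      by blast
  qed
qed

theorem theorem1p6:
  assumes "locally_precompact TYPE('a::{topological_group_add, t2_space})"
  shows "(metrizable_space (euclidean :: 'a topology) \<longleftrightarrow> P_space (euclidean :: 'a topology)) \<and>
         (P_space (euclidean :: 'a topology) \<longleftrightarrow> strong_Pytkeev (euclidean :: 'a topology))"
proof -
  obtain U V :: "'a set" where "open U" "0 \<in> U" "U \<subseteq> V" and V: "uminus ` V = V" "precompact V"
    using assms unfolding locally_precompact_def neighbourhood_base_at_def
    by (metis UNIV_I open_UNIV open_openin)
  then have "0 \<in> interior V"
    by (auto intro: interiorI)
  then show ?thesis
    using metrizable_imp_P_space[OF V(2,1)] P_space_imp_strong_Pytkeev
      strong_Pytkeev_imp_metrizable[OF V(2)] by blast
qed

end
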